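(* Let $V$ be a non-trivial real or complex vector space equipped with inner products $\langle\cdot,\cdot\rangle_1$ and $\langle\cdot,\cdot\rangle_2$, and let $m$ and $M$ be as defined in the context. For (linearly) independent vectors $u$ and $v$ in $V$, \[ -2\,\frac{M-m}{M+m}\le\frac{\operatorname{Re}\langle u,v\rangle_2}{\|u\|_2\|v\|_2}-\frac{\operatorname{Re}\langle u,v\rangle_1}{\|u\|_1\|v\|_1}\le2\,\frac{M-m}{M+m} \] and, if $\operatorname{Re}\langle u,v\rangle_1\ge0$, then \[ \frac{\operatorname{Re}\langle u,v\rangle_2}{\|u\|_2\|v\|_2}-\frac{\operatorname{Re}\langle u,v\rangle_1}{\|u\|_1\|v\|_1}\le\frac{M^2-m^2}{M^2+m^2}. \] Also, \[ -\frac{M^2-m^2}{M^2+m^2}\le\frac{|\langle u,v\rangle_2|}{\|u\|_2\|v\|_2}-\frac{|\langle u,v\rangle_1|}{\|u\|_1\|v\|_1}\le\frac{M^2-m^2}{M^2+m^2}. \]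
   Context: $V$ may be infinite-dimensional. Inner products are over the scalar field of $V$ (real or complex) and linear in the first variable; $\|v\|_j=\sqrt{\langle v,v\rangle_j}$ for $j=1,2$. Define \[ m=\inf_{0\ne v\in V}\frac{\|v\|_2}{\|v\|_1},\qquad M=\sup_{0\ne v\in V}\frac{\|v\|_2}{\|v\|_1}, \] so $0\le m\le M\le\infty$. If $M=\infty$, the quotients $\frac{M-m}{M+m}$ and $\frac{M^2-m^2}{M^2+m^2}$ are read as $1$. *)

theory Defs
  imports Complex_Main "HOL-Library.Extended_Real"
begin

text \<open>
  Scalars that are either the real or the complex numbers, so that both cases are treated at once.
  The norm is the absolute value. The lemma \<open>real_or_complex_cases\<close> shows that
  the class has no instances besides these two up to isomorphism.
\<close>

class real_or_complex = real_normed_field +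
  fixes scnj :: "'a \<Rightarrow> 'a"
    and sRe :: "'a \<Rightarrow> real"
  assumes scnj_add: "scnj (x + y) = scnj x + scnj y"
    and scnj_mult: "scnj (x * y) = scnj x * scnj y"
    and add_scnj_scaleR: "x + scnj x = (2 * sRe x) *\<^sub>R 1"
    and mult_scnj_scaleR: "x * scnj x = (norm x)\<^sup>2 *\<^sub>R 1"

instantiation real :: real_or_complex
begin
definition scnj_real :: "real \<Rightarrow> real" where "scnj_real x = x"
definition sRe_real :: "real \<Rightarrow> real" where "sRe_real x = x"
instance
  by standard (auto simp: scnj_real_def sRe_real_def power2_eq_square)
end

instantiation complex :: real_or_complex
begin
definition scnj_complex :: "complex \<Rightarrow> complex" where "scnj_complex = cnj"
definition sRe_complex :: "complex \<Rightarrow> real" where "sRe_complex = Re"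
instance
proof
  fix x y :: complex
  show "scnj (x + y) = scnj x + scnj y" "scnj (x * y) = scnj x * scnj y"
    by (simp_all add: scnj_complex_def)
  show "x + scnj x = (2 * sRe x) *\<^sub>R 1"
    by (rule complex_eqI) (simp_all add: scnj_complex_def sRe_complex_def)
  show "x * scnj x = (norm x)\<^sup>2 *\<^sub>R 1"
    unfolding scnj_complex_def cmod_power2
    by (rule complex_eqI) (simp_all add: power2_eq_square)
qed
end

lemma add_scnj: "x + scnj x = of_real (2 * sRe (x::'k::real_or_complex))"
  using add_scnj_scaleR[of x] by (simp only: of_real_def)

lemma mult_scnj: "x * scnj x = of_real ((norm (x::'k::real_or_complex))\<^sup>2)"
  using mult_scnj_scaleR[of x] by (simp only: of_real_def)

lemma scnj_eq: "scnj x = of_real (2 * sRe x) - (x::'k::real_or_complex)"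
  using add_scnj[of x] by (simp add: algebra_simps)

lemma scnj_of_real: "scnj (of_real r) = (of_real r :: 'k::real_or_complex)"
proof (cases "r = 0")
  case True
  then show ?thesis using scnj_add[of "0::'k" 0] by simp
next
  case False
  have "(of_real r :: 'k) * scnj (of_real r) = of_real r * of_real r"
    using mult_scnj[of "of_real r :: 'k"] by (simp add: power2_eq_square)
  then show ?thesis using False by simp
qed

lemma sRe_of_real: "sRe (of_real r :: 'k::real_or_complex) = r"
proof -
  have "(of_real (2 * r) :: 'k) = of_real (2 * sRe (of_real r :: 'k))"
    using add_scnj[of "of_real r :: 'k"] by (simp add: scnj_of_real)
  then show ?thesis by (simp only: of_real_eq_iff)
qed

lemma real_or_complex_cases:
  obtains (real) "\<And>x::'k::real_or_complex. x = of_real (sRe x)" "\<And>x::'k. scnj x = x"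
  | (complex) j :: "'k::real_or_complex" where "j * j = - 1"
      "bij (\<lambda>z. of_real (Re z) + of_real (Im z) * j)"
      "\<And>a b. scnj (of_real a + of_real b * j) = of_real a - of_real b * j"
      "\<And>a b. sRe (of_real a + of_real b * j) = a"
      "\<And>a b. norm (of_real a + of_real b * j) = sqrt (a\<^sup>2 + b\<^sup>2)"
proof (cases "\<forall>x::'k. x = of_real (sRe x)")
  case True
  then have *: "x = of_real (sRe x)" for x :: 'k by blast
  have "scnj x = x" for x :: 'k
    using scnj_of_real[of "sRe x", where 'k = 'k] by (simp only: *[of x, symmetric])
  then show ?thesis by (rule real[OF *])
next
  case False
  have im: "scnj (x - of_real (sRe x)) = - (x - of_real (sRe x))" for x :: 'k
  proof -
    have "scnj (x - of_real (sRe x)) = scnj x - of_real (sRe x)"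
      using scnj_add[of "x - of_real (sRe x)" "of_real (sRe x)"] by (simp add: scnj_of_real)
    then show ?thesis by (simp add: scnj_eq)
  qed
  from False obtain y0 :: 'k where y0: "y0 \<noteq> of_real (sRe y0)" by blast
  define y where "y = y0 - of_real (sRe y0)"
  have y: "y \<noteq> 0" "scnj y = - y" using y0 im[of y0] by (auto simp: y_def)
  define j where "j = of_real (inverse (norm y)) * y"
  have nj: "norm j = 1" using y by (simp add: j_def norm_mult del: of_real_inverse)
  have cj: "scnj j = - j" using y unfolding j_def scnj_mult scnj_of_real by simp
  have "- (j * j) = 1" using mult_scnj[of j] by (simp add: nj cj)
  then have jj: "j * j = - 1" by (metis minus_minus)
  have c: "scnj (of_real a + of_real b * j) = of_real a - of_real b * j" for a b
    by (simp add: scnj_add scnj_mult scnj_of_real cj)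
  have r: "sRe (of_real a + of_real b * j) = a" for a b
  proof -
    have "(of_real (2 * a) :: 'k) = of_real (2 * sRe (of_real a + of_real b * j))"
      using add_scnj[of "of_real a + of_real b * j"] by (simp add: c)
    then show ?thesis by (simp only: of_real_eq_iff)
  qed
  have n: "norm (of_real a + of_real b * j) = sqrt (a\<^sup>2 + b\<^sup>2)" for a b
  proof -
    have "(of_real a + of_real b * j) * (of_real a - of_real b * j)
        = of_real a * of_real a - of_real b * of_real b * (j * j)"
      by (simp add: algebra_simps)
    also have "\<dots> = of_real (a\<^sup>2 + b\<^sup>2)" by (simp add: jj power2_eq_square)
    finally have "(of_real ((norm (of_real a + of_real b * j))\<^sup>2) :: 'k) = of_real (a\<^sup>2 + b\<^sup>2)"
      using mult_scnj[of "of_real a + of_real b * j"] by (simp only: c)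
    then have "(norm (of_real a + of_real b * j))\<^sup>2 = a\<^sup>2 + b\<^sup>2" by (simp only: of_real_eq_iff)
    then show ?thesis by (metis norm_ge_zero real_sqrt_unique)
  qed
  have "inj (\<lambda>z. of_real (Re z) + of_real (Im z) * j)"
  proof (rule injI)
    fix z w assume eq: "of_real (Re z) + of_real (Im z) * j = of_real (Re w) + of_real (Im w) * j"
    then have re: "Re z = Re w" using r by metis
    have "j \<noteq> 0" using nj by auto
    with eq re have "Im z = Im w" by simp
    with re show "z = w" by (simp add: complex_eq_iff)
  qed
  moreover have "surj (\<lambda>z. of_real (Re z) + of_real (Im z) * j)"
  proof (rule surjI)
    fix x :: 'k
    define w where "w = x - of_real (sRe x)"
    have "scnj w = - w" unfolding w_def by (rule im)
    then have "scnj (w * j) = w * j" by (simp add: scnj_mult cj)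
    then have "of_real (2 * sRe (w * j)) = 2 * (w * j)"
      using add_scnj[of "w * j"] by (simp only: mult_2)
    then have "2 * of_real (sRe (w * j)) = 2 * (w * j)" by (simp only: of_real_mult of_real_numeral)
    then have "of_real (sRe (w * j)) = w * j" by (metis mult_left_cancel zero_neq_numeral)
    then have "of_real (- sRe (w * j)) * j = - (w * (j * j))" by (simp only: of_real_minus mult_minus_left mult.assoc)
    then have "of_real (- sRe (w * j)) * j = w" by (simp only: jj mult_minus_right mult_1_right minus_minus)
    then show "of_real (Re (Complex (sRe x) (- sRe (w * j))))
        + of_real (Im (Complex (sRe x) (- sRe (w * j)))) * j = x"
      by (simp add: w_def)
  qed
  ultimately have "bij (\<lambda>z. of_real (Re z) + of_real (Im z) * j)" by (rule bijI)
  from complex[OF jj this c r n] show ?thesis .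
qed

locale inner_product_space = vector_space scale
  for scale :: "'k::real_or_complex \<Rightarrow> 'v::ab_group_add \<Rightarrow> 'v"
  + fixes ip :: "'v \<Rightarrow> 'v \<Rightarrow> 'k"
  assumes ip_add_left: "ip (x + y) z = ip x z + ip y z"
    and ip_scale_left: "ip (scale c x) y = c * ip x y"
    and ip_commute: "ip y x = scnj (ip x y)"
    and ip_pos: "x \<noteq> 0 \<Longrightarrow> sRe (ip x x) > 0"
    \<comment> \<open>\<open>ip x x\<close> is real by \<open>ip_commute\<close>\<close>

definition ip_norm :: "('v \<Rightarrow> 'v \<Rightarrow> 'k::real_or_complex) \<Rightarrow> 'v \<Rightarrow> real" where
  "ip_norm ip v = sqrt (sRe (ip v v))"

text \<open>
  The quotient \<open>(b - a) / (b + a)\<close>, read as \<open>1\<close> for \<open>b = \<infinity>\<close>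
  (extended-real division would give \<open>\<infinity> / \<infinity> = 0\<close>). Note that \<open>b\<^sup>2 = \<infinity>\<close>
  holds exactly if \<open>\<bar>b\<bar> = \<infinity>\<close>.
\<close>

definition rel_diff :: "ereal \<Rightarrow> ereal \<Rightarrow> real" where
  "rel_diff b a = (if b = \<infinity> then 1
     else (real_of_ereal b - real_of_ereal a) / (real_of_ereal b + real_of_ereal a))"

end

theory Submission
  imports Defs
begin

text \<open>
  Write \<open>x\<close> and \<open>y\<close> for the cosines \<open>Re \<langle>u,v\<rangle> / (\<parallel>u\<parallel> \<parallel>v\<parallel>)\<close> in the first and the second
  inner product, and let \<open>u\<close> and \<open>v\<close> have norm \<open>1\<close> in the first one. Put \<open>P = \<parallel>u\<parallel>\<^sub>2 \<parallel>v\<parallel>\<^sub>2\<close>.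
  Comparing the two norms of \<open>u + v\<close>, and of \<open>u / \<parallel>u\<parallel>\<^sub>2 - v / \<parallel>v\<parallel>\<^sub>2\<close>, gives
  \<open>P (1 + y) \<le> M\<^sup>2 (1 + x)\<close> and \<open>m\<^sup>2 (1 - x) \<le> P (1 - y)\<close>,
  because \<open>\<parallel>u\<parallel>\<^sub>2\<^sup>2 + \<parallel>v\<parallel>\<^sub>2\<^sup>2 \<ge> 2 P\<close> and \<open>\<parallel>u\<parallel>\<^sub>2\<^sup>-\<^sup>2 + \<parallel>v\<parallel>\<^sub>2\<^sup>-\<^sup>2 \<ge> 2 / P\<close>.
  Eliminating \<open>P\<close> yields the generalized Wielandt inequality
  \<open>m\<^sup>2 (1 + y) (1 - x) \<le> M\<^sup>2 (1 + x) (1 - y)\<close> (lemma \<open>wielandt_inequality\<close>); in terms of angles it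
  says, for \<open>m > 0\<close>, that halving the angle and taking the tangent gives in the first inner product at
  most \<open>M / m\<close> times the value in the second.

  The bounds on \<open>y - x\<close> follow from it by real algebra (lemmas \<open>diff_le_if_wielandt\<close> and
  \<open>diff_le_if_wielandt_nonneg\<close>), and the bounds on \<open>x - y\<close> after replacing \<open>v\<close> by \<open>-v\<close>.
  For the absolute values, \<open>u\<close> is first multiplied by a scalar of modulus \<open>1\<close> that makes one of the two
  inner products real and nonnegative; the real part of the other is then at most its modulus, and the
  Wielandt inequality is monotone in the right direction. For \<open>M = \<infinity>\<close> all bounds reduce to the
  Cauchy--Schwarz inequality.
\<close>

section \<open>Scalars\<close>

lemma sRe_add: "sRe (x + y) = sRe x + sRe (y::'k::real_or_complex)"
proof -
  have "of_real (2 * sRe (x + y)) = (x + scnj x) + (y + scnj y)"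
    unfolding add_scnj[symmetric] by (simp add: scnj_add)
  also have "\<dots> = (of_real (2 * sRe x + 2 * sRe y) :: 'k)"
    by (simp only: add_scnj of_real_add)
  finally have "2 * sRe (x + y) = 2 * sRe x + 2 * sRe y" by (simp only: of_real_eq_iff)
  then show ?thesis by simp
qed

lemma sRe_of_real_mult: "sRe (of_real r * x) = r * sRe (x::'k::real_or_complex)"
proof -
  have "of_real (2 * sRe (of_real r * x)) = of_real r * (x + scnj x)"
    unfolding add_scnj[symmetric] by (simp add: scnj_mult scnj_of_real algebra_simps)
  also have "\<dots> = (of_real (r * (2 * sRe x)) :: 'k)"
    by (simp only: add_scnj of_real_mult)
  finally have "2 * sRe (of_real r * x) = r * (2 * sRe x)" by (simp only: of_real_eq_iff)
  then show ?thesis by simp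
qed

lemma scnj_scnj: "scnj (scnj x) = (x::'k::real_or_complex)"
proof -
  have "scnj (x + scnj x) = x + scnj x" by (simp only: add_scnj scnj_of_real)
  then show ?thesis by (simp add: scnj_add add.commute)
qed

lemma sRe_scnj: "sRe (scnj x) = sRe (x::'k::real_or_complex)"
proof -
  have "of_real (2 * sRe (scnj x)) = (of_real (2 * sRe x) :: 'k)"
    unfolding add_scnj[symmetric] by (simp add: scnj_scnj add.commute)
  then have "2 * sRe (scnj x) = 2 * sRe x" by (simp only: of_real_eq_iff)
  then show ?thesis by simp
qed

lemma norm_scnj: "norm (scnj x) = norm (x::'k::real_or_complex)"
proof -
  have "of_real ((norm (scnj x))\<^sup>2) = (of_real ((norm x)\<^sup>2) :: 'k)"
    unfolding mult_scnj[symmetric] by (simp add: scnj_scnj mult.commute)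
  then have "(norm (scnj x))\<^sup>2 = (norm x)\<^sup>2" by (simp only: of_real_eq_iff)
  then show ?thesis by simp
qed

lemma sRe_le_norm: "sRe x \<le> norm (x::'k::real_or_complex)"
proof -
  have "2 * \<bar>sRe x\<bar> = norm (of_real (2 * sRe x) :: 'k)" by (simp only: norm_of_real)
  also have "\<dots> \<le> norm x + norm (scnj x)" unfolding add_scnj[symmetric] by (rule norm_triangle_ineq)
  finally show ?thesis by (simp add: norm_scnj)
qed

lemma unit_scalar_to_norm:
  obtains c :: "'k::real_or_complex" where "norm c = 1" "c * z = of_real (norm z)"
proof (cases "z = 0")
  case True
  then show ?thesis using that[of 1] by simp
next
  case False
  define c where "c = of_real (1 / norm z) * scnj z"
  have "norm c = 1" using False unfolding c_def norm_mult norm_of_real norm_scnj by simp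
  moreover have "c * z = of_real (1 / norm z) * of_real ((norm z)\<^sup>2)"
    unfolding c_def mult_scnj[symmetric] by (simp only: mult_ac)
  then have "c * z = of_real (1 / norm z * (norm z)\<^sup>2)" by (simp only: of_real_mult)
  then have "c * z = of_real (norm z)" using False by (simp add: power2_eq_square)
  ultimately show ?thesis by (rule that)
qed

section \<open>Norms and angles\<close>

text \<open>The cosine of the real angle between two vectors; it is \<open>0\<close> if one of them is \<open>0\<close>.\<close>

definition ip_cos :: "('v \<Rightarrow> 'v \<Rightarrow> 'k::real_or_complex) \<Rightarrow> 'v \<Rightarrow> 'v \<Rightarrow> real" where
  "ip_cos ip u v = sRe (ip u v) / (ip_norm ip u * ip_norm ip v)"

text \<open>The cosine of the angle between the lines that two vectors span.\<close>

definition ip_abs_cos :: "('v \<Rightarrow> 'v \<Rightarrow> 'k::real_or_complex) \<Rightarrow> 'v \<Rightarrow> 'v \<Rightarrow> real" where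
  "ip_abs_cos ip u v = norm (ip u v) / (ip_norm ip u * ip_norm ip v)"

context inner_product_space
begin

lemma ip_add_right: "ip x (y + z) = ip x y + ip x z"
  by (metis ip_commute ip_add_left scnj_add)

lemma ip_scale_right: "ip x (scale c y) = scnj c * ip x y"
  by (metis ip_commute ip_scale_left scnj_mult)

lemma ip_minus_right: "ip x (- y) = - ip x y"
  using ip_add_right[of x y "- y"] ip_add_right[of x 0 0]
  by (simp add: eq_neg_iff_add_eq_0 add.commute)

lemma ip_norm_power2: "(ip_norm ip x)\<^sup>2 = sRe (ip x x)"
proof (cases "x = 0")
  case True
  have "ip x 0 = 0" using ip_add_right[of x 0 0] by simp
  then show ?thesis using True sRe_of_real[of 0, where 'k = 'k] by (simp add: ip_norm_def)
next
  case False
  then show ?thesis using ip_pos[of x] by (simp add: ip_norm_def)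
qed

lemma ip_norm_pos: "x \<noteq> 0 \<Longrightarrow> 0 < ip_norm ip x"
  unfolding ip_norm_def using ip_pos[of x] by simp

lemma ip_norm_nonneg: "0 \<le> ip_norm ip x"
  unfolding ip_norm_def by (simp flip: ip_norm_power2)

lemma ip_norm_scale: "ip_norm ip (scale c x) = norm c * ip_norm ip x"
proof -
  have "ip (scale c x) (scale c x) = (c * scnj c) * ip x x"
    by (simp only: ip_scale_left ip_scale_right mult_ac)
  then have "sRe (ip (scale c x) (scale c x)) = (norm c)\<^sup>2 * sRe (ip x x)"
    by (simp only: mult_scnj sRe_of_real_mult)
  then show ?thesis by (simp add: ip_norm_def real_sqrt_mult)
qed

lemma ip_norm_minus: "ip_norm ip (- x) = ip_norm ip x"
  using ip_norm_scale[of "- 1" x] by simp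

lemma ip_cos_minus_right: "ip_cos ip u (- v) = - ip_cos ip u v"
proof -
  have "sRe (- ip u v) = - sRe (ip u v)"
    using sRe_of_real_mult[of "- 1" "ip u v"] by simp
  then show ?thesis by (simp add: ip_cos_def ip_norm_minus ip_minus_right)
qed

lemma ip_norm_real_combination:
  assumes "u \<noteq> 0" "v \<noteq> 0"
  shows "(ip_norm ip (scale (of_real s) u + scale (of_real t) v))\<^sup>2
    = (s * ip_norm ip u)\<^sup>2 + (t * ip_norm ip v)\<^sup>2
      + 2 * ip_cos ip u v * (s * ip_norm ip u) * (t * ip_norm ip v)"
proof -
  have c: "sRe (ip u v) = ip_cos ip u v * ip_norm ip u * ip_norm ip v"
    using assms[THEN ip_norm_pos] by (simp add: ip_cos_def)
  have sym: "sRe (ip v u) = sRe (ip u v)"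
    unfolding ip_commute[of v u] by (rule sRe_scnj)
  have "(ip_norm ip (scale (of_real s) u + scale (of_real t) v))\<^sup>2
    = s * (s * sRe (ip u u)) + s * (t * sRe (ip u v)) + t * (s * sRe (ip v u)) + t * (t * sRe (ip v v))"
    unfolding ip_norm_power2 ip_add_left ip_add_right ip_scale_left ip_scale_right scnj_of_real
      sRe_add sRe_of_real_mult by (simp add: algebra_simps)
  then show ?thesis
    unfolding sym c ip_norm_power2[symmetric] by (simp add: algebra_simps power2_eq_square)
qed

text \<open>The Cauchy--Schwarz inequality: the sum of the normalized vectors has a nonnegative square norm.\<close>

lemma ip_cos_ge:
  assumes "u \<noteq> 0" "v \<noteq> 0"
  shows "- 1 \<le> ip_cos ip u v"
proof -
  have "0 \<le> (ip_norm ip (scale (of_real (1 / ip_norm ip u)) u + scale (of_real (1 / ip_norm ip v)) v))\<^sup>2"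
    by simp
  then show ?thesis
    unfolding ip_norm_real_combination[OF assms] using assms[THEN ip_norm_pos] by simp
qed

lemma ip_cos_le:
  assumes "u \<noteq> 0" "v \<noteq> 0"
  shows "ip_cos ip u v \<le> 1"
  using ip_cos_ge[of u "- v"] assms by (simp add: ip_cos_minus_right)

lemma ip_cos_le_abs_cos: "ip_cos ip u v \<le> ip_abs_cos ip u v"
  unfolding ip_cos_def ip_abs_cos_def
  by (intro divide_right_mono sRe_le_norm mult_nonneg_nonneg ip_norm_nonneg)

lemma ip_abs_cos_scale_unit: "norm c = 1 \<Longrightarrow> ip_abs_cos ip (scale c u) v = ip_abs_cos ip u v"
  by (simp add: ip_abs_cos_def ip_scale_left ip_norm_scale norm_mult)

lemma unit_scalar_ip_cos:
  obtains c where "norm c = 1" "ip_cos ip (scale c u) v = ip_abs_cos ip u v"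
proof -
  obtain c :: 'k where c: "norm c = 1" "c * ip u v = of_real (norm (ip u v))"
    by (rule unit_scalar_to_norm)
  then have "ip_cos ip (scale c u) v = ip_abs_cos ip u v"
    by (simp add: ip_cos_def ip_abs_cos_def ip_scale_left ip_norm_scale sRe_of_real)
  with c(1) show ?thesis by (rule that)
qed

lemma ip_abs_cos_nonneg: "0 \<le> ip_abs_cos ip u v"
  unfolding ip_abs_cos_def
  by (intro divide_nonneg_nonneg mult_nonneg_nonneg ip_norm_nonneg norm_ge_zero)

lemma ip_abs_cos_le:
  assumes "u \<noteq> 0" "v \<noteq> 0"
  shows "ip_abs_cos ip u v \<le> 1"
proof -
  obtain c where c: "norm c = 1" "ip_cos ip (scale c u) v = ip_abs_cos ip u v"
    by (rule unit_scalar_ip_cos)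
  have "scale c u \<noteq> 0" using c(1) assms(1) by auto
  then show ?thesis using ip_cos_le[of "scale c u" v] c(2) assms(2) by simp
qed

end

section \<open>The generalized Wielandt inequality\<close>

lemma wielandt_inequality:
  fixes scale :: "'k::real_or_complex \<Rightarrow> 'v::ab_group_add \<Rightarrow> 'v"
  assumes "inner_product_space scale ip1" "inner_product_space scale ip2"
    and lower: "\<And>w. m\<^sup>2 * (ip_norm ip1 w)\<^sup>2 \<le> (ip_norm ip2 w)\<^sup>2"
    and upper: "\<And>w. (ip_norm ip2 w)\<^sup>2 \<le> M\<^sup>2 * (ip_norm ip1 w)\<^sup>2"
    and nz: "u \<noteq> 0" "v \<noteq> 0"
  shows "m\<^sup>2 * ((1 + ip_cos ip2 u v) * (1 - ip_cos ip1 u v))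
    \<le> M\<^sup>2 * ((1 + ip_cos ip1 u v) * (1 - ip_cos ip2 u v))"
proof -
  interpret I1: inner_product_space scale ip1 by fact
  interpret I2: inner_product_space scale ip2 by fact
  define x y where "x = ip_cos ip1 u v" and "y = ip_cos ip2 u v"
  have y: "- 1 \<le> y" "y \<le> 1"
    unfolding y_def using I2.ip_cos_ge I2.ip_cos_le nz by auto
  define a b c d where "a = ip_norm ip1 u" and "b = ip_norm ip1 v"
    and "c = ip_norm ip2 u" and "d = ip_norm ip2 v"
  have pos: "0 < a" "0 < b" "0 < c" "0 < d"
    using nz I1.ip_norm_pos I2.ip_norm_pos by (auto simp: a_def b_def c_def d_def)
  \<comment> \<open>The second-norm lengths of \<open>u\<close> and \<open>v\<close> after normalizing them in the first norm.\<close>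
  define A B where "A = c / a" and "B = d / b"
  have AB: "0 < A" "0 < B" using pos by (auto simp: A_def B_def)
  \<comment> \<open>The upper bound for the sum of the vectors normalized in the first norm.\<close>
  have "A\<^sup>2 + B\<^sup>2 + 2 * y * A * B \<le> M\<^sup>2 * (2 + 2 * x)"
    using upper[of "scale (of_real (1 / a)) u + scale (of_real (1 / b)) v"] pos
    unfolding I1.ip_norm_real_combination[OF nz] I2.ip_norm_real_combination[OF nz]
    by (simp add: a_def[symmetric] b_def[symmetric] c_def[symmetric] d_def[symmetric]
        x_def[symmetric] y_def[symmetric] A_def B_def)
  moreover have sq: "2 * (A * B) \<le> A\<^sup>2 + B\<^sup>2"
    using sum_squares_bound[of A B] by (simp add: mult.assoc)
  ultimately have up: "A * B * (1 + y) \<le> M\<^sup>2 * (1 + x)"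
    by (simp add: algebra_simps)
  \<comment> \<open>The lower bound for the difference of the vectors normalized in the second norm.\<close>
  have "m\<^sup>2 * ((1 / A)\<^sup>2 + (1 / B)\<^sup>2 - 2 * x * (1 / A) * (1 / B)) \<le> 2 - 2 * y"
    using lower[of "scale (of_real (1 / c)) u + scale (of_real (- 1 / d)) v"] pos
    unfolding I1.ip_norm_real_combination[OF nz] I2.ip_norm_real_combination[OF nz]
    by (simp add: a_def[symmetric] b_def[symmetric] c_def[symmetric] d_def[symmetric]
        x_def[symmetric] y_def[symmetric] A_def B_def)
  moreover have "m\<^sup>2 * (2 * (1 / A) * (1 / B) - 2 * x * (1 / A) * (1 / B))
      \<le> m\<^sup>2 * ((1 / A)\<^sup>2 + (1 / B)\<^sup>2 - 2 * x * (1 / A) * (1 / B))"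
    using sum_squares_bound[of "1 / A" "1 / B"] by (intro mult_left_mono) auto
  ultimately have "m\<^sup>2 * (2 * (1 / A) * (1 / B) - 2 * x * (1 / A) * (1 / B)) \<le> 2 - 2 * y"
    by linarith
  then have low: "m\<^sup>2 * (1 - x) \<le> A * B * (1 - y)"
    using AB by (simp add: field_simps)
  have "m\<^sup>2 * (1 - x) * (1 + y) \<le> A * B * (1 - y) * (1 + y)"
    using low y by (intro mult_right_mono) auto
  also have "\<dots> = A * B * (1 + y) * (1 - y)" by (simp only: mult_ac)
  also have "\<dots> \<le> M\<^sup>2 * (1 + x) * (1 - y)"
    using up y by (intro mult_right_mono) auto
  finally show ?thesis unfolding x_def y_def by (simp only: mult_ac)
qed

text \<open>The same inequality with the two cosines exchanged, which is the previous one for \<open>u\<close> and \<open>-v\<close>.\<close>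

lemma wielandt_inequality_swap:
  fixes scale :: "'k::real_or_complex \<Rightarrow> 'v::ab_group_add \<Rightarrow> 'v"
  assumes "inner_product_space scale ip1" "inner_product_space scale ip2"
    and "\<And>w. m\<^sup>2 * (ip_norm ip1 w)\<^sup>2 \<le> (ip_norm ip2 w)\<^sup>2"
    and "\<And>w. (ip_norm ip2 w)\<^sup>2 \<le> M\<^sup>2 * (ip_norm ip1 w)\<^sup>2"
    and "u \<noteq> 0" "v \<noteq> 0"
  shows "m\<^sup>2 * ((1 + ip_cos ip1 u v) * (1 - ip_cos ip2 u v))
    \<le> M\<^sup>2 * ((1 + ip_cos ip2 u v) * (1 - ip_cos ip1 u v))"
  using wielandt_inequality[OF assms(1-5), of "- v"] assms(6)
  by (simp add: inner_product_space.ip_cos_minus_right[OF assms(1)]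
      inner_product_space.ip_cos_minus_right[OF assms(2)] mult.commute)

lemma wielandt_inequality_abs:
  fixes scale :: "'k::real_or_complex \<Rightarrow> 'v::ab_group_add \<Rightarrow> 'v"
  assumes "inner_product_space scale ip1" "inner_product_space scale ip2"
    and bounds: "\<And>w. m\<^sup>2 * (ip_norm ip1 w)\<^sup>2 \<le> (ip_norm ip2 w)\<^sup>2"
      "\<And>w. (ip_norm ip2 w)\<^sup>2 \<le> M\<^sup>2 * (ip_norm ip1 w)\<^sup>2"
    and nz: "u \<noteq> 0" "v \<noteq> 0"
  shows "m\<^sup>2 * ((1 + ip_abs_cos ip2 u v) * (1 - ip_abs_cos ip1 u v))
      \<le> M\<^sup>2 * ((1 + ip_abs_cos ip1 u v) * (1 - ip_abs_cos ip2 u v))" (is ?A)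
    and "m\<^sup>2 * ((1 + ip_abs_cos ip1 u v) * (1 - ip_abs_cos ip2 u v))
      \<le> M\<^sup>2 * ((1 + ip_abs_cos ip2 u v) * (1 - ip_abs_cos ip1 u v))" (is ?B)
proof -
  interpret I1: inner_product_space scale ip1 by fact
  interpret I2: inner_product_space scale ip2 by fact
  note abs = I1.ip_abs_cos_nonneg[of u v] I1.ip_abs_cos_le[OF nz]
    I2.ip_abs_cos_nonneg[of u v] I2.ip_abs_cos_le[OF nz]
  show ?A
  proof -
    obtain c where c: "norm c = 1" "ip_cos ip2 (scale c u) v = ip_abs_cos ip2 u v"
      by (rule I2.unit_scalar_ip_cos)
    have "scale c u \<noteq> 0" using c(1) nz(1) by auto
    note W = wielandt_inequality[OF assms(1,2) bounds this nz(2)]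
    have le: "ip_cos ip1 (scale c u) v \<le> ip_abs_cos ip1 u v"
      using I1.ip_cos_le_abs_cos[of "scale c u" v] I1.ip_abs_cos_scale_unit[OF c(1)] by simp
    have "m\<^sup>2 * ((1 + ip_abs_cos ip2 u v) * (1 - ip_abs_cos ip1 u v))
        \<le> m\<^sup>2 * ((1 + ip_abs_cos ip2 u v) * (1 - ip_cos ip1 (scale c u) v))"
      using le abs by (intro mult_left_mono) auto
    also have "\<dots> \<le> M\<^sup>2 * ((1 + ip_cos ip1 (scale c u) v) * (1 - ip_abs_cos ip2 u v))"
      using W by (simp only: c(2))
    also have "\<dots> \<le> M\<^sup>2 * ((1 + ip_abs_cos ip1 u v) * (1 - ip_abs_cos ip2 u v))"
      using le abs by (intro mult_left_mono mult_right_mono) auto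
    finally show ?thesis .
  qed
  show ?B
  proof -
    obtain c where c: "norm c = 1" "ip_cos ip1 (scale c u) v = ip_abs_cos ip1 u v"
      by (rule I1.unit_scalar_ip_cos)
    have "scale c u \<noteq> 0" using c(1) nz(1) by auto
    note W = wielandt_inequality_swap[OF assms(1,2) bounds this nz(2)]
    have le: "ip_cos ip2 (scale c u) v \<le> ip_abs_cos ip2 u v"
      using I2.ip_cos_le_abs_cos[of "scale c u" v] I2.ip_abs_cos_scale_unit[OF c(1)] by simp
    have "m\<^sup>2 * ((1 + ip_abs_cos ip1 u v) * (1 - ip_abs_cos ip2 u v))
        \<le> m\<^sup>2 * ((1 + ip_abs_cos ip1 u v) * (1 - ip_cos ip2 (scale c u) v))"
      using le abs by (intro mult_left_mono) auto
    also have "\<dots> \<le> M\<^sup>2 * ((1 + ip_cos ip2 (scale c u) v) * (1 - ip_abs_cos ip1 u v))"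
      using W by (simp only: c(2))
    also have "\<dots> \<le> M\<^sup>2 * ((1 + ip_abs_cos ip2 u v) * (1 - ip_abs_cos ip1 u v))"
      using le abs by (intro mult_left_mono mult_right_mono) auto
    finally show ?thesis .
  qed
qed

section \<open>Bounds on the difference of the cosines\<close>

text \<open>
  With \<open>\<alpha>\<^sup>2 = (1 + y) (1 - x)\<close> and \<open>\<beta>\<^sup>2 = (1 + x) (1 - y)\<close> the hypothesis reads \<open>m \<alpha> \<le> M \<beta>\<close>, whereas
  \<open>2 (y - x) = \<alpha>\<^sup>2 - \<beta>\<^sup>2\<close> and \<open>\<alpha> + \<beta> \<le> 2\<close>.
\<close>

lemma diff_le_if_wielandt:
  fixes m M x y :: real
  assumes m: "0 \<le> m" and M: "0 < M"
    and x: "- 1 \<le> x" "x \<le> 1" and y: "- 1 \<le> y" "y \<le> 1"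
    and mM: "m \<le> M"
    and W: "m\<^sup>2 * ((1 + y) * (1 - x)) \<le> M\<^sup>2 * ((1 + x) * (1 - y))"
  shows "y - x \<le> 2 * ((M - m) / (M + m))"
proof -
  define \<alpha> \<beta> where "\<alpha> = sqrt ((1 + y) * (1 - x))" and "\<beta> = sqrt ((1 + x) * (1 - y))"
  have nonneg: "0 \<le> \<alpha>" "0 \<le> \<beta>" using x y by (auto simp: \<alpha>_def \<beta>_def)
  have sq: "\<alpha>\<^sup>2 = (1 + y) * (1 - x)" "\<beta>\<^sup>2 = (1 + x) * (1 - y)"
    using x y by (auto simp: \<alpha>_def \<beta>_def)
  have "(m * \<alpha>)\<^sup>2 \<le> (M * \<beta>)\<^sup>2" unfolding power_mult_distrib sq by (rule W)
  then have "m * \<alpha> \<le> M * \<beta>" by (rule power2_le_imp_le) (use M nonneg in auto)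
  then have le: "(M + m) * (\<alpha> - \<beta>) \<le> (M - m) * (\<alpha> + \<beta>)" by (simp add: algebra_simps)
  have "\<alpha> \<le> ((1 + y) + (1 - x)) / 2" "\<beta> \<le> ((1 + x) + (1 - y)) / 2"
    unfolding \<alpha>_def \<beta>_def using x y by (intro arith_geo_mean_sqrt; simp)+
  then have "\<alpha> + \<beta> \<le> 2" by (simp add: field_simps)
  then have four: "(\<alpha> + \<beta>)\<^sup>2 \<le> 2\<^sup>2" using nonneg by (intro power_mono) auto
  have "2 * ((M + m) * (y - x)) = (M + m) * (\<alpha>\<^sup>2 - \<beta>\<^sup>2)"
    unfolding sq by (simp add: algebra_simps)
  also have "\<dots> = (M + m) * (\<alpha> - \<beta>) * (\<alpha> + \<beta>)" by (simp add: algebra_simps power2_eq_square)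
  also have "\<dots> \<le> (M - m) * (\<alpha> + \<beta>) * (\<alpha> + \<beta>)" using le nonneg by (intro mult_right_mono) auto
  also have "\<dots> = (M - m) * (\<alpha> + \<beta>)\<^sup>2" by (simp add: power2_eq_square)
  also have "\<dots> \<le> (M - m) * 2\<^sup>2" using four mM by (intro mult_left_mono) auto
  finally have "(M + m) * (y - x) \<le> 2 * (M - m)" by simp
  then show ?thesis using m M by (simp add: field_simps)
qed

lemma diff_le_if_wielandt_nonneg:
  fixes m M x y :: real
  assumes m: "0 \<le> m" and M: "0 < M" and x: "0 \<le> x" and mM: "m \<le> M"
    and W: "m\<^sup>2 * ((1 + y) * (1 - x)) \<le> M\<^sup>2 * ((1 + x) * (1 - y))"
  shows "y - x \<le> (M\<^sup>2 - m\<^sup>2) / (M\<^sup>2 + m\<^sup>2)"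
proof -
  have pos: "0 < M\<^sup>2 + m\<^sup>2" using M by (simp add: add_pos_nonneg)
  have diff: "0 \<le> M\<^sup>2 - m\<^sup>2" using m mM by (simp add: power_mono)
  show ?thesis
  proof (cases "0 \<le> y")
    case True
    have "(M\<^sup>2 + m\<^sup>2) * (y - x) \<le> (M\<^sup>2 - m\<^sup>2) * (1 - x * y)"
      using W by (simp add: algebra_simps)
    also have "\<dots> \<le> (M\<^sup>2 - m\<^sup>2) * 1"
      using x True diff by (intro mult_left_mono) auto
    finally show ?thesis using pos by (simp add: pos_le_divide_eq mult.commute)
  next
    case False
    then have "y - x \<le> 0" using x by simp
    also have "0 \<le> (M\<^sup>2 - m\<^sup>2) / (M\<^sup>2 + m\<^sup>2)" using pos diff by simp
    finally show ?thesis .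
  qed
qed

theorem theorem2p8:
  fixes scale :: "'k::real_or_complex \<Rightarrow> 'v::ab_group_add \<Rightarrow> 'v"
    and ip1 ip2 :: "'v \<Rightarrow> 'v \<Rightarrow> 'k"
    and m M :: ereal
    and u v :: 'v
  assumes nontrivial: "\<exists>x::'v. x \<noteq> 0"
    and ip1: "inner_product_space scale ip1"
    and ip2: "inner_product_space scale ip2"
    and m: "m = (INF x\<in>{x. x \<noteq> 0}. ereal (ip_norm ip2 x / ip_norm ip1 x))"
    and M: "M = (SUP x\<in>{x. x \<noteq> 0}. ereal (ip_norm ip2 x / ip_norm ip1 x))"
    and indep: "u \<noteq> v" "\<not> module.dependent scale {u, v}"
  shows
    "- 2 * rel_diff M m
        \<le> sRe (ip2 u v) / (ip_norm ip2 u * ip_norm ip2 v)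
          - sRe (ip1 u v) / (ip_norm ip1 u * ip_norm ip1 v)
     \<and> sRe (ip2 u v) / (ip_norm ip2 u * ip_norm ip2 v)
          - sRe (ip1 u v) / (ip_norm ip1 u * ip_norm ip1 v)
        \<le> 2 * rel_diff M m
     \<and> (sRe (ip1 u v) \<ge> 0 \<longrightarrow>
          sRe (ip2 u v) / (ip_norm ip2 u * ip_norm ip2 v)
            - sRe (ip1 u v) / (ip_norm ip1 u * ip_norm ip1 v)
          \<le> rel_diff (M\<^sup>2) (m\<^sup>2))
     \<and> - rel_diff (M\<^sup>2) (m\<^sup>2)
        \<le> norm (ip2 u v) / (ip_norm ip2 u * ip_norm ip2 v)
          - norm (ip1 u v) / (ip_norm ip1 u * ip_norm ip1 v)
     \<and> norm (ip2 u v) / (ip_norm ip2 u * ip_norm ip2 v)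
          - norm (ip1 u v) / (ip_norm ip1 u * ip_norm ip1 v)
        \<le> rel_diff (M\<^sup>2) (m\<^sup>2)"
proof -
  interpret I1: inner_product_space scale ip1 by (rule ip1)
  interpret I2: inner_product_space scale ip2 by (rule ip2)
  have nz: "u \<noteq> 0" "v \<noteq> 0"
    using indep(2) I1.dependent_zero[of "{u, v}"] by auto
  note abs = I1.ip_abs_cos_nonneg[of u v] I1.ip_abs_cos_le[OF nz]
    I2.ip_abs_cos_nonneg[of u v] I2.ip_abs_cos_le[OF nz]
  note cos = I1.ip_cos_ge[OF nz] I1.ip_cos_le[OF nz] I2.ip_cos_ge[OF nz] I2.ip_cos_le[OF nz]
  have cos_nonneg: "0 \<le> ip_cos ip1 u v" if "0 \<le> sRe (ip1 u v)"
    unfolding ip_cos_def using that I1.ip_norm_pos[OF nz(1)] I1.ip_norm_pos[OF nz(2)]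
    by simp
  have "- 2 * rel_diff M m \<le> ip_cos ip2 u v - ip_cos ip1 u v
    \<and> ip_cos ip2 u v - ip_cos ip1 u v \<le> 2 * rel_diff M m
    \<and> (0 \<le> sRe (ip1 u v) \<longrightarrow> ip_cos ip2 u v - ip_cos ip1 u v \<le> rel_diff (M\<^sup>2) (m\<^sup>2))
    \<and> - rel_diff (M\<^sup>2) (m\<^sup>2) \<le> ip_abs_cos ip2 u v - ip_abs_cos ip1 u v
    \<and> ip_abs_cos ip2 u v - ip_abs_cos ip1 u v \<le> rel_diff (M\<^sup>2) (m\<^sup>2)"
  proof (cases "M = \<infinity>")
    case True
    then have "rel_diff M m = 1" "rel_diff (M\<^sup>2) (m\<^sup>2) = 1"
      by (auto simp: rel_diff_def power2_eq_square)
    then show ?thesis using abs cos cos_nonneg by auto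
  next
    case False
    define q where "q w = ip_norm ip2 w / ip_norm ip1 w" for w
    have q_pos: "0 < q w" if "w \<noteq> 0" for w
      using that I1.ip_norm_pos I2.ip_norm_pos by (simp add: q_def)
    have le: "m \<le> ereal (q w)" "ereal (q w) \<le> M" if "w \<noteq> 0" for w
      using that by (auto simp: m M q_def intro: INF_lower SUP_upper)
    have "0 \<le> m"
      unfolding m using q_pos by (intro INF_greatest) (auto simp: q_def less_imp_le)
    then obtain r where r: "m = ereal r" "0 \<le> r"
      using le(1)[OF nz(1)] by (cases m) auto
    obtain R where R: "M = ereal R"
      using False le(2)[OF nz(1)] by (cases M) auto
    have rR: "r \<le> q w" "q w \<le> R" if "w \<noteq> 0" for w
      using le[OF that] by (auto simp: r R)
    have "0 < R" "r \<le> R" using rR[OF nz(1)] q_pos[OF nz(1)] by auto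
    have eq: "rel_diff M m = (R - r) / (R + r)"
        "rel_diff (M\<^sup>2) (m\<^sup>2) = (R\<^sup>2 - r\<^sup>2) / (R\<^sup>2 + r\<^sup>2)"
      by (auto simp: rel_diff_def r R)
    have zero: "(ip_norm ip1 0)\<^sup>2 = 0" "(ip_norm ip2 0)\<^sup>2 = 0"
      using I1.ip_norm_scale[of 0 0] I2.ip_norm_scale[of 0 0] by auto
    have lower: "r\<^sup>2 * (ip_norm ip1 w)\<^sup>2 \<le> (ip_norm ip2 w)\<^sup>2" for w
    proof (cases "w = 0")
      case False
      then have "r * ip_norm ip1 w \<le> ip_norm ip2 w"
        using rR(1)[OF False] I1.ip_norm_pos[OF False] by (simp add: q_def field_simps)
      then have "(r * ip_norm ip1 w)\<^sup>2 \<le> (ip_norm ip2 w)\<^sup>2"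
        using r(2) I1.ip_norm_pos[OF False] by (intro power_mono) auto
      then show ?thesis by (simp add: power_mult_distrib)
    qed (simp add: zero)
    have upper: "(ip_norm ip2 w)\<^sup>2 \<le> R\<^sup>2 * (ip_norm ip1 w)\<^sup>2" for w
    proof (cases "w = 0")
      case False
      then have "ip_norm ip2 w \<le> R * ip_norm ip1 w"
        using rR(2)[OF False] I1.ip_norm_pos[OF False] by (simp add: q_def field_simps)
      then have "(ip_norm ip2 w)\<^sup>2 \<le> (R * ip_norm ip1 w)\<^sup>2"
        using I2.ip_norm_pos[OF False] by (intro power_mono) auto
      then show ?thesis by (simp add: power_mult_distrib)
    qed (simp add: zero)
    note W = wielandt_inequality[OF ip1 ip2 lower upper nz]
    note W_swap = wielandt_inequality_swap[OF ip1 ip2 lower upper nz]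
    note W_abs = wielandt_inequality_abs[OF ip1 ip2 lower upper nz]
    note bound = diff_le_if_wielandt[OF r(2) \<open>0 < R\<close> _ _ _ _ \<open>r \<le> R\<close>]
    note bound_nonneg = diff_le_if_wielandt_nonneg[OF r(2) \<open>0 < R\<close> _ \<open>r \<le> R\<close>]
    show ?thesis
      unfolding eq
      using bound[OF cos W] bound[OF cos(3,4,1,2) W_swap] bound_nonneg[OF cos_nonneg W]
        bound_nonneg[OF abs(1) W_abs(1)] bound_nonneg[OF abs(3) W_abs(2)]
      by (intro conjI impI; linarith)
  qed
  then show ?thesis unfolding ip_cos_def ip_abs_cos_def .
qed

end
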